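(* Let $q$ be a positive rational number that is neither an integer nor the reciprocal of an integer, and let $\alpha = \sqrt[n]{q}$ be a positive irreducible $n$-th root of $q$ (where $n$ is a positive integer). Then the following statements hold. (1) The additive monoid $\mathbb{N}_0[\alpha]$ is atomic, and its set of atoms is $\{\alpha^k \mid k \in \mathbb{N}_0\}$. (2) For every nonzero $b \in \mathbb{N}_0[\alpha]$, the set of lengths $\mathsf{L}(b)$ is an arithmetic progression with difference $|\mathsf{n}(q) - \mathsf{d}(q)|$.
   Context: $\mathbb{N}_0$ is the set of nonnegative integers. For a positive real $\alpha$, $\mathbb{N}_0[\alpha] = \{p(\alpha) \mid p(X) \in \mathbb{N}_0[X]\}$, where $\mathbb{N}_0[X]$ is the set of polynomials with nonnegative integer coefficients; it is regarded as a monoid under addition. For a positive rational $q$, $\mathsf{n}(q)$ and $\mathsf{d}(q)$ denote the unique positive integers with $q = \mathsf{n}(q)/\mathsf{d}(q)$ and $\gcd(\mathsf{n}(q), \mathsf{d}(q)) = 1$. An $n$-th root $\alpha$ of $q$ is called irreducible if $\alpha, \alpha^2, \dots, \alpha^{n-1}$ are all irrational. An atom of $M = \mathbb{N}_0[\alpha]$ is a nonzero element that is not the sum of two nonzero elements of $M$. $M$ is atomic if every nonzero element is a sum of finitely many atoms. A factorization of $b \in M$ is a formal sum (finite multiset) of atoms of $M$ whose actual sum is $b$; its length is the number of atoms in it, counting repetitions; and $\mathsf{L}(b)$ is the set of lengths of all factorizations of $b$. Arithmetic progressions may be finite (including a single element) or infinite: a set is an arithmetic progression with difference $d$ if it has the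 form $\{a + dk \mid k \in \mathbb{N}_0, \ k \le K\}$ for some integer $a$ and some $K \in \mathbb{N}_0 \cup \{\infty\}$. *)

theory Defs
  imports
    Complex_Main
    "HOL-Library.Multiset"
    "HOL-Library.Extended_Nat"
    "HOL-Computational_Algebra.Polynomial"
begin

definition numer :: "rat \<Rightarrow> int" where
  "numer q = fst (quotient_of q)"

definition denom :: "rat \<Rightarrow> int" where
  "denom q = snd (quotient_of q)"

definition irreducible_root :: "nat \<Rightarrow> rat \<Rightarrow> real \<Rightarrow> bool" where
  "irreducible_root n q \<alpha> \<longleftrightarrow> \<alpha> ^ n = of_rat q \<and> (\<forall>k\<in>{1..<n}. \<alpha> ^ k \<notin> \<rat>)"

definition nat_poly_values :: "real \<Rightarrow> real set" where
  "nat_poly_values \<alpha> = {poly (map_poly real p) \<alpha> | p :: nat poly. True}"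

text \<open>
  Below, \<open>M\<close> is the carrier of an additive monoid. Nonzero stands in for noninvertible, so the
  definitions are meant for monoids in which \<open>0\<close> is the only invertible element, such as
  monoids of nonnegative reals.
\<close>

definition atoms :: "'a::comm_monoid_add set \<Rightarrow> 'a set" where
  "atoms M = {a \<in> M. a \<noteq> 0 \<and> \<not> (\<exists>x\<in>M. \<exists>y\<in>M. x \<noteq> 0 \<and> y \<noteq> 0 \<and> a = x + y)}"

definition factorizations :: "'a::comm_monoid_add set \<Rightarrow> 'a \<Rightarrow> 'a multiset set" where
  "factorizations M b = {z. set_mset z \<subseteq> atoms M \<and> sum_mset z = b}"

definition atomic_monoid :: "'a::comm_monoid_add set \<Rightarrow> bool" where
  "atomic_monoid M \<longleftrightarrow> (\<forall>b\<in>M. b \<noteq> 0 \<longrightarrow> factorizations M b \<noteq> {})"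

definition length_set :: "'a::comm_monoid_add set \<Rightarrow> 'a \<Rightarrow> nat set" where
  "length_set M b = size ` factorizations M b"

text \<open>The bound \<open>K = \<infinity>\<close> gives the infinite progressions; all progressions are nonempty.\<close>

definition arith_progression :: "int \<Rightarrow> int set \<Rightarrow> bool" where
  "arith_progression d S \<longleftrightarrow> (\<exists>(a::int) (K::enat). S = {a + d * int k | k. enat k \<le> K})"

end

theory Submission
  imports Defs "HOL-Computational_Algebra.Fundamental_Theorem_Algebra"
begin

text \<open>
  Write \<open>q = a / c\<close> in lowest terms. A factor \<open>f\<close> of \<open>X ^ n - q\<close> over the rationals has only complex
  roots of modulus \<open>\<alpha>\<close>, so its constant and leading coefficients force \<open>\<alpha> ^ degree f\<close> to be rational;
  hence \<open>X ^ n - q\<close> is the minimal polynomial of \<open>\<alpha>\<close>. Splitting an integer relation between powers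
  of \<open>\<alpha>\<close> into residue classes of exponents modulo \<open>n\<close> and clearing denominators shows that \<open>c\<close>
  divides its last and \<open>a\<close> its first nonzero coefficient.

  The identity \<open>a * \<alpha> ^ i = c * \<alpha> ^ (i + n)\<close> permits exchanging the larger number of copies for the
  smaller one, which shortens a sum of powers by exactly \<open>\<bar>a - c\<bar>\<close>. By the divisibility just
  stated, a sum where no such exchange is possible is determined by its value. So every sum
  descends in steps of \<open>\<bar>a - c\<bar>\<close> to the unique shortest one, and the lengths form an arithmetic
  progression. As every exchange produces a repeated power, a single power is never the outcome of
  one, so it is an atom.
\<close>

section \<open>Linear independence of \<open>1\<close>, \<open>\<alpha>\<close>, ...,
  \<open>\<alpha> ^ (n - 1)\<close> over the rationals\<close>

lemma poly_map_of_rat_add: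
  "poly (map_poly of_rat (f + g)) (x :: 'a::field_char_0) =
     poly (map_poly of_rat f) x + poly (map_poly of_rat g) x"
proof -
  have "map_poly of_rat (f + g) = map_poly of_rat f + (map_poly of_rat g :: 'a poly)"
    by (rule poly_eqI) (simp add: coeff_map_poly of_rat_add)
  then show ?thesis by simp
qed

lemma poly_map_of_rat_mult:
  "poly (map_poly of_rat (f * g)) (x :: 'a::field_char_0) =
     poly (map_poly of_rat f) x * poly (map_poly of_rat g) x"
proof -
  have "map_poly of_rat (f * g) = map_poly of_rat f * (map_poly of_rat g :: 'a poly)"
    by (rule poly_eqI) (simp add: coeff_map_poly coeff_mult of_rat_sum of_rat_mult)
  then show ?thesis by simp
qed

lemma poly_map_of_rat_binomial:
  "poly (map_poly of_rat (monom 1 n - [:q:])) (x :: 'a::field_char_0) = x ^ n - of_rat q"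
proof -
  have "map_poly of_rat (monom 1 n - [:q:]) = monom 1 n - [:of_rat q :: 'a:]"
    by (rule poly_eqI) (simp add: coeff_map_poly coeff_pCons of_rat_diff split: nat.split)
  then show ?thesis by (simp add: poly_monom)
qed

lemma of_real_of_rat: "of_real (of_rat r) = (of_rat r :: complex)"
  by (cases r) (simp add: Fract_of_int_quotient of_rat_divide)

lemma norm_of_rat: "norm (of_rat r :: complex) = of_rat \<bar>r\<bar>"
  unfolding of_real_of_rat[symmetric] norm_of_real by (simp add: abs_if of_rat_minus)

text \<open>Over the complex numbers, the constant coefficient of \<open>f\<close> is, up to sign,
  its leading coefficient times the product of its roots. Each root has modulus
  \<open>\<alpha>\<close>, being an \<open>n\<close>-th root of \<open>q\<close>, so taking absolute
  values expresses \<open>\<alpha> ^ degree f\<close> as a quotient of rationals.\<close>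

lemma power_degree_rational:
  fixes \<alpha> :: real
  assumes "\<alpha> > 0" and root: "\<alpha> ^ n = of_rat q" and "n > 0"
    and dvd: "f dvd monom 1 n - [:q:]" and "f \<noteq> 0"
  shows "\<alpha> ^ degree f \<in> \<rat>"
proof -
  define F :: "complex poly" where "F = map_poly of_rat f"
  have deg: "degree F = degree f" and lc: "lead_coeff F = of_rat (lead_coeff f)"
    by (simp_all add: F_def degree_map_poly coeff_map_poly)
  obtain z where z: "smult (lead_coeff F) (\<Prod>i<degree F. [:- z i, 1:]) = F"
    using complex_poly_decompose' .
  have norm_z: "norm (z i) = \<alpha>" if "i < degree F" for i
  proof -
    have "poly F (z i) = 0"
      using that by (subst z[symmetric]) (auto simp: poly_prod)
    moreover obtain g where "monom 1 n - [:q:] = f * g" using dvd by (rule dvdE)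
    ultimately have "z i ^ n = of_rat q"
      using poly_map_of_rat_mult[of f g "z i"] poly_map_of_rat_binomial[of n q "z i"]
      by (simp add: F_def)
    also have "\<dots> = of_real (\<alpha> ^ n)"
      by (simp add: root of_real_of_rat)
    finally have "norm (z i) ^ n = \<alpha> ^ n"
      using \<open>\<alpha> > 0\<close> by (metis norm_power norm_of_real abs_of_pos zero_less_power)
    then show ?thesis
      using \<open>\<alpha> > 0\<close> \<open>n > 0\<close> by (simp add: power_eq_iff_eq_base)
  qed
  have "norm (poly F 0) = norm (lead_coeff F) * (\<Prod>i<degree F. norm (z i))"
    by (subst z[symmetric]) (simp add: poly_prod norm_mult flip: prod_norm)
  also have "(\<Prod>i<degree F. norm (z i)) = \<alpha> ^ degree f"
    using norm_z deg by simp
  finally have "of_rat \<bar>coeff f 0\<bar> = of_rat \<bar>lead_coeff f\<bar> * \<alpha> ^ degree f"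
    unfolding lc by (simp add: F_def poly_0_coeff_0 coeff_map_poly norm_of_rat)
  then have "\<alpha> ^ degree f = of_rat (\<bar>coeff f 0\<bar> / \<bar>lead_coeff f\<bar>)"
    using \<open>f \<noteq> 0\<close> by (simp add: of_rat_divide field_simps)
  then show ?thesis by simp
qed

text \<open>A rational polynomial \<open>h\<close> of least degree vanishing at
  \<open>\<alpha>\<close> divides \<open>X ^ n - q\<close>, since the remainder also vanishes at
  \<open>\<alpha>\<close>. So \<open>\<alpha> ^ degree h\<close> is rational, and irreducibility
  leaves no positive degree below \<open>n\<close>.\<close>

lemma irreducible_root_degree:
  assumes "\<alpha> > 0" and irr: "irreducible_root n q \<alpha>" and "n > 0"
    and "f \<noteq> 0" and "poly (map_poly of_rat f) \<alpha> = 0"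
  shows "n \<le> degree f"
proof -
  let ?P = "\<lambda>h. h \<noteq> 0 \<and> poly (map_poly of_rat h) \<alpha> = 0"
  have root: "\<alpha> ^ n = of_rat q" and irrational: "\<And>k. k \<in> {1..<n} \<Longrightarrow> \<alpha> ^ k \<notin> \<rat>"
    using irr by (auto simp: irreducible_root_def)
  obtain h where h: "?P h" and min: "\<And>g. ?P g \<Longrightarrow> degree h \<le> degree g"
    using ex_has_least_nat[of ?P f degree] assms(4,5) by blast
  define r where "r = (monom 1 n - [:q:]) mod h"
  have "poly (map_poly of_rat ((monom 1 n - [:q:]) div h * h + r)) \<alpha> = 0"
    unfolding r_def div_mult_mod_eq by (simp only: poly_map_of_rat_binomial root diff_self)
  then have "poly (map_poly of_rat r) \<alpha> = 0"
    using h by (simp add: poly_map_of_rat_add poly_map_of_rat_mult)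
  then have "r = 0"
    using min[of r] h degree_mod_less[of h "monom 1 n - [:q:]"] by (fastforce simp: r_def)
  then have "h dvd monom 1 n - [:q:]" by (simp add: r_def mod_eq_0_iff_dvd)
  then have "\<alpha> ^ degree h \<in> \<rat>"
    using power_degree_rational[OF \<open>\<alpha> > 0\<close> root \<open>n > 0\<close>] h by blast
  moreover have "degree h \<noteq> 0"
  proof
    assume "degree h = 0"
    then obtain c where "h = [:c:]" by (rule degree_eq_zeroE)
    then show False using h by (simp add: map_poly_pCons)
  qed
  ultimately have "n \<le> degree h" using irrational[of "degree h"] by force
  then show ?thesis using min assms(4,5) by fastforce
qed


section \<open>Divisibility in integer relations between powers of \<alpha>\<close>

lemma poly_map_of_rat_sum:
  "poly (map_poly of_rat (\<Sum>i\<in>A. f i)) (x :: 'a::field_char_0) =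
     (\<Sum>i\<in>A. poly (map_poly of_rat (f i)) x)"
  by (induction A rule: infinite_finite_induct) (simp_all add: poly_map_of_rat_add)

lemma quotient_numer_denom:
  "q = of_int (numer q) / of_int (denom q)" "denom q > 0" "coprime (numer q) (denom q)"
  by (auto simp: numer_def denom_def quotient_of_denom_pos'
      intro!: quotient_of_div quotient_of_coprime prod.collapse[symmetric])

text \<open>Writing \<open>\<alpha> ^ i\<close> as
  \<open>q ^ (i div n) * \<alpha> ^ (i mod n)\<close> turns the relation into a rational polynomial
  of degree below \<open>n\<close> that vanishes at \<open>\<alpha>\<close>. All its coefficients
  are therefore 0, one for each residue class.\<close>

lemma residue_class_sum_eq_0:
  fixes h :: "nat \<Rightarrow> int"
  assumes "\<alpha> > 0" and irr: "irreducible_root n q \<alpha>" and "n > 0"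
    and zero: "(\<Sum>i\<le>D. of_int (h i) * \<alpha> ^ i) = 0" and "r < n"
  shows "(\<Sum>i | i \<le> D \<and> i mod n = r.
            h i * numer q ^ (i div n) * denom q ^ (D div n - i div n)) = 0"
proof -
  define f where "f = (\<Sum>i\<le>D. monom (of_int (h i) * q ^ (i div n)) (i mod n))"
  have \<alpha>n: "\<alpha> ^ n = of_rat q" using irr by (simp add: irreducible_root_def)
  have "poly (map_poly of_rat f) \<alpha> = (\<Sum>i\<le>D. of_int (h i) * ((\<alpha> ^ n) ^ (i div n) * \<alpha> ^ (i mod n)))"
    unfolding f_def poly_map_of_rat_sum
    by (rule sum.cong) (simp_all add: map_poly_monom poly_monom of_rat_mult of_rat_power \<alpha>n)
  also have "\<dots> = 0"
    unfolding zero[symmetric] by (simp flip: power_mult power_add)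
  finally have "poly (map_poly of_rat f) \<alpha> = 0" .
  moreover have "degree f < n"
  proof -
    have "i mod n \<le> n - 1" for i
      using \<open>n > 0\<close> mod_less_divisor[of n i] by linarith
    then have "degree f \<le> n - 1"
      unfolding f_def by (intro degree_sum_le) (auto intro: order.trans[OF degree_monom_le])
    then show ?thesis using \<open>n > 0\<close> by linarith
  qed
  ultimately have "f = 0"
    using irreducible_root_degree[OF \<open>\<alpha> > 0\<close> irr \<open>n > 0\<close>, of f] by auto
  \<comment> \<open>The exponents of \<open>q\<close> in \<open>f\<close> are at most
    \<open>D div n\<close>, so this power of the denominator makes every term an integer.\<close>
  then have "0 = of_int (denom q) ^ (D div n) * coeff f r" by simp
  also have "\<dots> = (\<Sum>i\<le>D. if i mod n = r
        then of_int (denom q) ^ (D div n) * (of_int (h i) * q ^ (i div n)) else 0)"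
    unfolding f_def coeff_sum coeff_monom sum_distrib_left by (rule sum.cong) auto
  also have "\<dots> = (\<Sum>i | i \<le> D \<and> i mod n = r.
        of_int (denom q) ^ (D div n) * (of_int (h i) * q ^ (i div n)))"
    by (rule sum.mono_neutral_cong_right) auto
  also have "\<dots> = of_int (\<Sum>i | i \<le> D \<and> i mod n = r.
            h i * numer q ^ (i div n) * denom q ^ (D div n - i div n))"
    unfolding of_int_sum
  proof (rule sum.cong)
    fix i assume "i \<in> {i. i \<le> D \<and> i mod n = r}"
    then have le: "i div n \<le> D div n" by (simp add: div_le_mono)
    have "of_int (denom q) ^ (D div n) * q ^ (i div n) =
        of_int (denom q) ^ (D div n - i div n) * (of_int (denom q) * q) ^ (i div n)"
      using le by (simp add: power_mult_distrib flip: power_add mult.assoc)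
    also have "of_int (denom q) * q = of_int (numer q)"
      using quotient_numer_denom[of q] by (simp add: field_simps)
    finally show "of_int (denom q) ^ (D div n) * (of_int (h i) * q ^ (i div n)) =
        of_int (h i * numer q ^ (i div n) * denom q ^ (D div n - i div n))"
      by (simp add: algebra_simps)
  qed simp
  finally show ?thesis by (simp del: of_int_sum)
qed

lemma div_less_div_if_mod_eq:
  fixes i j n :: nat
  assumes "i < j" "i mod n = j mod n"
  shows "i div n < j div n"
  using assms by (metis div_le_mono div_mult_mod_eq le_neq_implies_less less_imp_le_nat less_irrefl)

text \<open>In the residue class of \<open>D\<close>, every earlier term keeps a factor
  \<open>denom q\<close>, while the term of \<open>D\<close> carries only a power of the coprime
  \<open>numer q\<close>. For \<open>D < n\<close> the class has no earlier term at all.\<close>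

lemma denom_dvd_last_coeff:
  fixes h :: "nat \<Rightarrow> int"
  assumes "\<alpha> > 0" "irreducible_root n q \<alpha>" "n > 0"
    and "(\<Sum>i\<le>D. of_int (h i) * \<alpha> ^ i) = 0"
  shows "denom q dvd h D" and "D < n \<Longrightarrow> h D = 0"
proof -
  define R where "R = {i. i < D \<and> i mod n = D mod n}"
  define g where "g = (\<lambda>i. h i * numer q ^ (i div n) * denom q ^ (D div n - i div n))"
  have "{i. i \<le> D \<and> i mod n = D mod n} = insert D R" by (auto simp: R_def)
  then have eq: "h D * numer q ^ (D div n) + sum g R = 0"
    using residue_class_sum_eq_0[OF assms, of "D mod n"] \<open>n > 0\<close> by (simp add: R_def g_def)
  have "denom q dvd sum g R"
    by (rule dvd_sum) (auto simp: R_def g_def div_less_div_if_mod_eq intro!: dvd_mult dvd_power)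
  then have "denom q dvd h D * numer q ^ (D div n)"
    using eq by (metis dvd_0_right dvd_add_left_iff)
  then show "denom q dvd h D"
    using quotient_numer_denom(3)[of q]
    by (simp add: coprime_commute coprime_dvd_mult_left_iff)
  show "h D = 0" if "D < n"
  proof -
    have "R = {}" using that by (auto simp: R_def)
    then show ?thesis using eq that by simp
  qed
qed

text \<open>Dual argument at the low end: in the residue class of \<open>m\<close>, the later terms
  carry at least one more factor \<open>numer q\<close> than the term of \<open>m\<close>.
  Cancelling the common power leaves one factor, which is coprime to the denominator.\<close>

lemma numer_dvd_first_coeff:
  fixes h :: "nat \<Rightarrow> int"
  assumes "q > 0" "\<alpha> > 0" "irreducible_root n q \<alpha>" "n > 0"
    and "(\<Sum>i\<le>D. of_int (h i) * \<alpha> ^ i) = 0"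
    and "m \<le> D" and below: "\<And>i. i < m \<Longrightarrow> h i = 0"
  shows "numer q dvd h m"
proof -
  define R where "R = {i. m < i \<and> i \<le> D \<and> i mod n = m mod n}"
  define g where "g = (\<lambda>i. h i * numer q ^ (i div n) * denom q ^ (D div n - i div n))"
  have "sum g {i. i \<le> D \<and> i mod n = m mod n} = sum g (insert m R)"
    using \<open>m \<le> D\<close> below
    by (intro sum.mono_neutral_right) (auto simp: R_def g_def not_less le_less)
  then have eq: "g m + sum g R = 0"
    using residue_class_sum_eq_0[OF assms(2-5), of "m mod n"] \<open>n > 0\<close>
    by (simp add: R_def g_def)
  have "numer q ^ Suc (m div n) dvd sum g R"
    by (rule dvd_sum)
       (auto simp: R_def g_def div_less_div_if_mod_eq Suc_le_eq
         intro!: dvd_mult2[OF dvd_mult] le_imp_power_dvd simp del: power_Suc)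
  then have "numer q ^ Suc (m div n) dvd g m"
    using eq by (metis dvd_0_right dvd_add_left_iff)
  moreover have "numer q \<noteq> 0"
    using \<open>q > 0\<close> quotient_numer_denom(1)[of q] by auto
  ultimately have "numer q dvd h m * denom q ^ (D div n - m div n)"
    by (simp add: g_def mult_ac)
  then show ?thesis
    using quotient_numer_denom(3)[of q] by (simp add: coprime_dvd_mult_left_iff)
qed


section \<open>Arithmetic progressions from descent\<close>

text \<open>Each element of \<open>S\<close> reaches \<open>L\<close> in finitely many steps of size
  \<open>d\<close>. The set \<open>T\<close> of step counts is closed downwards, so it is a finite
  initial segment or all naturals.\<close>

lemma arith_progression_if_descending:
  fixes S :: "nat set"
  assumes "d > 0" and "L \<in> S" and desc: "\<And>l. l \<in> S \<Longrightarrow> l = L \<or> (\<exists>l'\<in>S. l = l' + d)"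
  shows "arith_progression (int d) (int ` S)"
proof -
  define T where "T = {k. L + d * k \<in> S}"
  have "\<exists>k. l = L + d * k" if "l \<in> S" for l
    using that
  proof (induction l rule: less_induct)
    case (less l)
    show ?case
    proof (cases "l = L")
      case True
      then show ?thesis by (intro exI[of _ 0]) simp
    next
      case False
      then obtain l' where "l' \<in> S" "l = l' + d" using desc less.prems by blast
      then obtain k where "l' = L + d * k" using less.IH[of l'] \<open>d > 0\<close> by auto
      then show ?thesis using \<open>l = l' + d\<close> by (intro exI[of _ "Suc k"]) simp
    qed
  qed
  then have S_eq: "S = (\<lambda>k. L + d * k) ` T" by (auto simp: T_def)
  have down: "i \<in> T" if "k \<in> T" "i \<le> k" for i k
    using \<open>i \<le> k\<close>
  proof (induction rule: inc_induct)
    case (step j)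
    then show ?case using desc[of "L + d * Suc j"] \<open>d > 0\<close> by (auto simp: T_def)
  qed (fact \<open>k \<in> T\<close>)
  have "0 \<in> T" using \<open>L \<in> S\<close> by (simp add: T_def)
  have "\<exists>K. T = {k. enat k \<le> K}"
  proof (cases "finite T")
    case True
    then have "T = {k. enat k \<le> enat (Max T)}"
      using \<open>0 \<in> T\<close> down[OF Max_in] by auto
    then show ?thesis by blast
  next
    case False
    \<comment> \<open>An infinite \<open>T\<close> is unbounded, so some member of it lies above
      \<open>k\<close>.\<close>
    have "k \<in> T" for k
      using False down[of _ k] by (meson finite_nat_set_iff_bounded_le nat_le_linear)
    then have "T = {k. enat k \<le> \<infinity>}" by auto
    then show ?thesis by blast
  qed
  then obtain K where "T = {k. enat k \<le> K}" ..
  then have "int ` S = {int L + int d * int k | k. enat k \<le> K}"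
    unfolding S_eq image_image by auto
  then show ?thesis unfolding arith_progression_def by blast
qed

section \<open>Weights of multisets of exponents\<close>

text \<open>Formal sums of powers of \<open>\<alpha>\<close> are encoded as multisets of exponents.\<close>

definition weight :: "real \<Rightarrow> nat multiset \<Rightarrow> real" where
  "weight \<alpha> m = (\<Sum>i\<in>#m. \<alpha> ^ i)"

lemma weight_simps [simp]:
  "weight \<alpha> {#} = 0"
  "weight \<alpha> (add_mset i m) = \<alpha> ^ i + weight \<alpha> m"
  "weight \<alpha> (m + m') = weight \<alpha> m + weight \<alpha> m'"
  "weight \<alpha> (replicate_mset k i) = of_nat k * \<alpha> ^ i"
  by (simp_all add: weight_def)

lemma weight_pos: "\<alpha> > 0 \<Longrightarrow> m \<noteq> {#} \<Longrightarrow> weight \<alpha> m > 0"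
proof (induction m)
  case (add i m)
  then show ?case by (cases "m = {#}") (auto intro: add_pos_pos)
qed simp

lemma weight_image_Suc: "weight \<alpha> (image_mset Suc m) = \<alpha> * weight \<alpha> m"
  by (induction m) (simp_all add: algebra_simps)

lemma weight_eq_sum:
  assumes "\<And>i. i \<in># m \<Longrightarrow> i \<le> D"
  shows "weight \<alpha> m = (\<Sum>i\<le>D. real (count m i) * \<alpha> ^ i)"
  using assms
proof (induction m)
  case (add j m)
  have "(\<Sum>i\<le>D. real (count (add_mset j m) i) * \<alpha> ^ i) =
      (\<Sum>i\<le>D. (if i = j then \<alpha> ^ i else 0) + real (count m i) * \<alpha> ^ i)"
    by (rule sum.cong) (auto simp: algebra_simps)
  then show ?case using add by (simp add: sum.distrib)
qed simp

lemma nat_poly_values_eq_weights: "nat_poly_values \<alpha> = range (weight \<alpha>)"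
proof
  have "poly (map_poly real p) \<alpha> \<in> range (weight \<alpha>)" for p
  proof (induction p)
    case (pCons a p)
    then obtain m where "poly (map_poly real p) \<alpha> = weight \<alpha> m" by blast
    \<comment> \<open>Multiplication by the variable raises every exponent by one; the new constant
      coefficient contributes \<open>a\<close> copies of the exponent 0.\<close>
    then have "poly (map_poly real (pCons a p)) \<alpha> =
        weight \<alpha> (replicate_mset a 0 + image_mset Suc m)"
      by (simp add: map_poly_pCons weight_image_Suc)
    then show ?case by blast
  qed (auto intro!: image_eqI[of _ _ "{#}"])
  then show "nat_poly_values \<alpha> \<subseteq> range (weight \<alpha>)"
    by (auto simp: nat_poly_values_def)
next
  have "\<exists>p. weight \<alpha> m = poly (map_poly real p) \<alpha>" for m
  proof (induction m)
    case (add i m)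
    then obtain p where "weight \<alpha> m = poly (map_poly real p) \<alpha>" by blast
    moreover have "map_poly real (monom 1 i + p) = monom 1 i + map_poly real p"
      by (rule poly_eqI) (simp add: coeff_map_poly)
    ultimately have "weight \<alpha> (add_mset i m) = poly (map_poly real (monom 1 i + p)) \<alpha>"
      by (simp add: poly_monom)
    then show ?case by blast
  qed (auto intro!: exI[of _ 0])
  then show "range (weight \<alpha>) \<subseteq> nat_poly_values \<alpha>"
    unfolding nat_poly_values_def by blast
qed

section \<open>Exchanges, atoms and lengths\<close>

text \<open>Common form of the cases \<open>q < 1\<close> and \<open>q > 1\<close>: \<open>x\<close>
  copies of an exponent \<open>i\<close> in \<open>I\<close> can be traded for \<open>y\<close>
  copies of \<open>s i\<close>. The last assumption says that a multiset admitting no such trade is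
  determined by its weight.\<close>

locale exchange =
  fixes \<alpha> :: real and x y :: nat and I :: "nat set" and s :: "nat \<Rightarrow> nat"
  assumes \<alpha>_pos: "\<alpha> > 0" and y_ge_2: "2 \<le> y" and y_less_x: "y < x"
    and exchange: "i \<in> I \<Longrightarrow> of_nat x * \<alpha> ^ i = of_nat y * \<alpha> ^ s i"
    and reduced_unique:
      "(\<And>i. i \<in> I \<Longrightarrow> count m i < x) \<Longrightarrow> (\<And>i. i \<in> I \<Longrightarrow> count m' i < x) \<Longrightarrow>
       weight \<alpha> m = weight \<alpha> m' \<Longrightarrow> m = m'"
begin

definition reduced :: "nat multiset \<Rightarrow> bool" where
  "reduced m \<longleftrightarrow> (\<forall>i\<in>I. count m i < x)"

text \<open>The repeated exponent \<open>j\<close> is recorded in order to tell outcomes of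
  exchanges from single powers.\<close>

lemma exchange_step:
  assumes "\<not> reduced m"
  obtains m' j where "weight \<alpha> m' = weight \<alpha> m" "size m = size m' + (x - y)" "count m' j \<ge> 2"
proof -
  from assms obtain i where "i \<in> I" "x \<le> count m i" by (auto simp: reduced_def)
  then obtain r where m: "m = replicate_mset x i + r"
    by (metis count_le_replicate_mset_subset_eq subset_mset.le_iff_add)
  show thesis
  proof
    show "weight \<alpha> (replicate_mset y (s i) + r) = weight \<alpha> m"
      using exchange[OF \<open>i \<in> I\<close>] by (simp add: m)
    show "size m = size (replicate_mset y (s i) + r) + (x - y)"
      using y_less_x by (simp add: m)
    show "count (replicate_mset y (s i) + r) (s i) \<ge> 2"
      using y_ge_2 by simp
  qed
qed

text \<open>Exchanging stops because every exchange shortens the multiset. If any took place, the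
  last one left a repeated exponent.\<close>

lemma ex_reduced:
  "\<exists>t. reduced t \<and> weight \<alpha> t = weight \<alpha> m \<and> (t = m \<or> (\<exists>j. count t j \<ge> 2))"
proof (induction "size m" arbitrary: m rule: less_induct)
  case less
  show ?case
  proof (cases "reduced m")
    case False
    then obtain m' j where m': "weight \<alpha> m' = weight \<alpha> m" "size m = size m' + (x - y)"
        "count m' j \<ge> 2"
      by (rule exchange_step)
    then show ?thesis using less[of m'] y_less_x by fastforce
  qed blast
qed

text \<open>Since \<open>x > 1\<close>, the multiset \<open>{#k#}\<close> is reduced, so by
  uniqueness it is the reduced form of \<open>m\<close>. Having no repeated exponent, it did not
  arise by an exchange, hence equals \<open>m\<close>.\<close>

lemma weight_eq_power_iff: "weight \<alpha> m = \<alpha> ^ k \<longleftrightarrow> m = {#k#}"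
proof
  assume eq: "weight \<alpha> m = \<alpha> ^ k"
  obtain t where t: "reduced t" "weight \<alpha> t = weight \<alpha> m" "t = m \<or> (\<exists>j. count t j \<ge> 2)"
    using ex_reduced[of m] by blast
  have "t = {#k#}"
    using t eq y_ge_2 y_less_x by (intro reduced_unique) (auto simp: reduced_def)
  then show "m = {#k#}" using t(3) by (auto split: if_splits)
qed simp

lemma atoms_eq: "atoms (nat_poly_values \<alpha>) = range (power \<alpha>)"
proof
  show "atoms (nat_poly_values \<alpha>) \<subseteq> range (power \<alpha>)"
  proof
    fix a assume "a \<in> atoms (nat_poly_values \<alpha>)"
    then obtain m where m: "a = weight \<alpha> m" "a \<noteq> 0"
      and irred: "\<And>u v. weight \<alpha> u \<noteq> 0 \<Longrightarrow> weight \<alpha> v \<noteq> 0 \<Longrightarrow> a \<noteq> weight \<alpha> u + weight \<alpha> v"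
      by (auto simp: atoms_def nat_poly_values_eq_weights)
    then obtain i r where r: "m = add_mset i r" by (cases m) auto
    have "r = {#}"
    proof (rule ccontr)
      assume "r \<noteq> {#}"
      then have "weight \<alpha> r \<noteq> 0" using weight_pos[OF \<alpha>_pos, of r] by simp
      then show False using irred[of "{#i#}" r] \<alpha>_pos m(1) r by simp
    qed
    then show "a \<in> range (power \<alpha>)" using m(1) r by simp
  qed
next
  have "\<alpha> ^ k \<noteq> weight \<alpha> u + weight \<alpha> v" if "weight \<alpha> u \<noteq> 0" "weight \<alpha> v \<noteq> 0" for k u v
  proof
    assume "\<alpha> ^ k = weight \<alpha> u + weight \<alpha> v"
    then have "u + v = {#k#}" by (simp flip: weight_eq_power_iff)
    then have "size u + size v = 1" by (metis size_single size_union)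
    then have "size u = 0 \<or> size v = 0" by linarith
    then show False using that by auto
  qed
  moreover have "\<alpha> ^ k \<in> range (weight \<alpha>)" for k
    by (rule range_eqI[of _ _ "{#k#}"]) simp
  ultimately show "range (power \<alpha>) \<subseteq> atoms (nat_poly_values \<alpha>)"
    using \<alpha>_pos by (auto simp: atoms_def nat_poly_values_eq_weights)
qed

text \<open>All atoms are powers of \<open>\<alpha>\<close>, so choosing an exponent for each of
  them by \<open>inv\<close> turns a factorization into a multiset of exponents of the same
  size.\<close>

lemma factorizations_eq:
  "factorizations (nat_poly_values \<alpha>) b = image_mset (power \<alpha>) ` {m. weight \<alpha> m = b}"
proof
  show "factorizations (nat_poly_values \<alpha>) b \<subseteq> image_mset (power \<alpha>) ` {m. weight \<alpha> m = b}"
  proof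
    fix z assume z: "z \<in> factorizations (nat_poly_values \<alpha>) b"
    have "image_mset (power \<alpha>) (image_mset (inv (power \<alpha>)) z) = image_mset (\<lambda>a. a) z"
      unfolding multiset.map_comp using z
      by (intro image_mset_cong) (auto simp: factorizations_def atoms_eq f_inv_into_f)
    then have "z = image_mset (power \<alpha>) (image_mset (inv (power \<alpha>)) z)" by simp
    moreover from this have "weight \<alpha> (image_mset (inv (power \<alpha>)) z) = b"
      using z by (simp add: weight_def factorizations_def)
    ultimately show "z \<in> image_mset (power \<alpha>) ` {m. weight \<alpha> m = b}" by blast
  qed
next
  show "image_mset (power \<alpha>) ` {m. weight \<alpha> m = b} \<subseteq> factorizations (nat_poly_values \<alpha>) b"
    by (auto simp: factorizations_def atoms_eq weight_def)
qed

lemma atomic: "atomic_monoid (nat_poly_values \<alpha>)"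
  unfolding atomic_monoid_def factorizations_eq by (auto simp: nat_poly_values_eq_weights)

lemma arith_progression_lengths:
  assumes "b \<in> nat_poly_values \<alpha>"
  shows "arith_progression (int x - int y) (int ` length_set (nat_poly_values \<alpha>) b)"
proof -
  have lengths: "length_set (nat_poly_values \<alpha>) b = size ` {m. weight \<alpha> m = b}"
    by (simp add: length_set_def factorizations_eq image_image)
  from assms obtain t where t: "reduced t" "weight \<alpha> t = b"
    using ex_reduced by (auto simp: nat_poly_values_eq_weights)
  have "arith_progression (int (x - y)) (int ` size ` {m. weight \<alpha> m = b})"
  proof (rule arith_progression_if_descending)
    show "x - y > 0" using y_less_x by simp
    show "size t \<in> size ` {m. weight \<alpha> m = b}" using t by blast
    fix l assume "l \<in> size ` {m. weight \<alpha> m = b}"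
    then obtain m where m: "weight \<alpha> m = b" "l = size m" by blast
    show "l = size t \<or> (\<exists>l'\<in>size ` {m. weight \<alpha> m = b}. l = l' + (x - y))"
    proof (cases "reduced m")
      case True
      then have "m = t" using t m by (intro reduced_unique) (auto simp: reduced_def)
      then show ?thesis using m by simp
    next
      case False
      then show ?thesis using m by (metis (mono_tags, lifting) exchange_step image_eqI mem_Collect_eq)
    qed
  qed
  then show ?thesis using y_less_x by (simp add: lengths)
qed

end

section \<open>Uniqueness of reduced sums\<close>

lemma weight_diff_eq_0:
  assumes "weight \<alpha> m = weight \<alpha> m'" and "\<And>i. i \<in># m + m' \<Longrightarrow> i \<le> D"
  shows "(\<Sum>i\<le>D. of_int (int (count m i) - int (count m' i)) * \<alpha> ^ i) = 0"
proof -
  have "weight \<alpha> m - weight \<alpha> m' = 0" using assms(1) by simp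
  then show ?thesis
    using assms(2)
    by (simp add: weight_eq_sum[of m D] weight_eq_sum[of m' D] left_diff_distrib sum_subtractf)
qed

text \<open>At the largest exponent where the counts differ, \<open>denom q\<close> divides their
  difference, which is too small to be a nonzero multiple. Exponents below \<open>n\<close> have
  unrestricted counts; there the difference vanishes outright.\<close>

lemma eq_if_counts_less_denom:
  assumes "\<alpha> > 0" "irreducible_root n q \<alpha>" "n > 0"
    and small: "\<And>i. n \<le> i \<Longrightarrow> int (count m i) < denom q"
      "\<And>i. n \<le> i \<Longrightarrow> int (count m' i) < denom q"
    and eq: "weight \<alpha> m = weight \<alpha> m'"
  shows "m = m'"
proof (rule ccontr)
  assume "m \<noteq> m'"
  define N where "N = {i. count m i \<noteq> count m' i}"
  have "N \<subseteq> set_mset (m + m')"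
    by (intro subsetI, rule ccontr) (simp add: N_def not_in_iff)
  then have "finite N" by (rule finite_subset) simp
  moreover have "N \<noteq> {}" using \<open>m \<noteq> m'\<close> by (auto simp: N_def multiset_eq_iff)
  ultimately have "Max N \<in> N" and above: "\<And>i. Max N < i \<Longrightarrow> i \<notin> N"
    by (auto dest: Max_ge)
  define h where "h = (\<lambda>i. int (count m i) - int (count m' i))"
  define E where "E = Max (insert (Max N) (set_mset (m + m')))"
  have "(\<Sum>i\<le>E. of_int (h i) * \<alpha> ^ i) = 0"
    unfolding h_def by (rule weight_diff_eq_0[OF eq]) (auto simp: E_def)
  \<comment> \<open>The bound \<open>E\<close> covers all exponents of both sums. Cutting off the
    zero coefficients above \<open>Max N\<close> makes \<open>h (Max N)\<close> the last one, as the
    divisibility result requires.\<close>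
  also have "(\<Sum>i\<le>E. of_int (h i) * \<alpha> ^ i) = (\<Sum>i\<le>Max N. of_int (h i) * \<alpha> ^ i)"
  proof (rule sum.mono_neutral_right)
    have "Max N \<le> E" unfolding E_def by (rule Max_ge) simp_all
    then show "{..Max N} \<subseteq> {..E}" by simp
    have "h i = 0" if "Max N < i" for i
      using above[OF that] by (simp add: h_def N_def)
    then show "\<forall>i\<in>{..E} - {..Max N}. of_int (h i) * \<alpha> ^ i = 0" by simp
  qed simp
  finally have sum0: "(\<Sum>i\<le>Max N. of_int (h i) * \<alpha> ^ i) = 0" .
  have "h (Max N) \<noteq> 0" using \<open>Max N \<in> N\<close> by (simp add: h_def N_def)
  then have "n \<le> Max N"
    using denom_dvd_last_coeff(2)[OF assms(1-3) sum0] by linarith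
  then have "\<bar>h (Max N)\<bar> < denom q"
    using small[of "Max N"] by (simp add: h_def)
  moreover have "denom q \<le> \<bar>h (Max N)\<bar>"
    using dvd_imp_le_int[OF \<open>h (Max N) \<noteq> 0\<close> denom_dvd_last_coeff(1)[OF assms(1-3) sum0]]
    by linarith
  ultimately show False by linarith
qed

text \<open>Here the comparison takes place at the smallest exponent where the counts differ, with
  \<open>numer q\<close> as the divisor.\<close>

lemma eq_if_counts_less_numer:
  assumes "q > 0" "\<alpha> > 0" "irreducible_root n q \<alpha>" "n > 0"
    and small: "\<And>i. int (count m i) < numer q" "\<And>i. int (count m' i) < numer q"
    and eq: "weight \<alpha> m = weight \<alpha> m'"
  shows "m = m'"
proof (rule ccontr)
  assume "m \<noteq> m'"
  define h where "h = (\<lambda>i. int (count m i) - int (count m' i))"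
  define k where "k = (LEAST i. h i \<noteq> 0)"
  have "\<exists>i. h i \<noteq> 0" using \<open>m \<noteq> m'\<close> by (auto simp: h_def multiset_eq_iff)
  then have "h k \<noteq> 0" unfolding k_def by (rule LeastI_ex)
  have below: "h i = 0" if "i < k" for i
    using not_less_Least[of i "\<lambda>i. h i \<noteq> 0"] that by (simp add: k_def)
  define E where "E = Max (insert k (set_mset (m + m')))"
  have "(\<Sum>i\<le>E. of_int (h i) * \<alpha> ^ i) = 0"
    unfolding h_def by (rule weight_diff_eq_0[OF eq]) (auto simp: E_def)
  then have "numer q dvd h k"
    using below by (intro numer_dvd_first_coeff[OF assms(1-4)]) (auto simp: E_def)
  then have "numer q \<le> \<bar>h k\<bar>" using dvd_imp_le_int[OF \<open>h k \<noteq> 0\<close>] by fastforce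
  moreover have "\<bar>h k\<bar> < numer q" using small[of k] by (simp add: h_def)
  ultimately show False by linarith
qed

section \<open>The cases \<open>q < 1\<close> and \<open>q > 1\<close>\<close>

lemma numer_denom_ge_2:
  assumes "q > 0" "q \<notin> \<int>" "\<not> (\<exists>m::int. q = 1 / of_int m)"
  shows "numer q \<ge> 2" "denom q \<ge> 2"
proof -
  have "denom q \<noteq> 1" using quotient_numer_denom(1)[of q] assms(2) by (metis Ints_of_int div_by_1 of_int_1)
  then show "denom q \<ge> 2" using quotient_numer_denom(2)[of q] by linarith
  have "numer q \<noteq> 1" using quotient_numer_denom(1)[of q] assms(3) by (metis of_int_1)
  moreover have "numer q > 0"
    using quotient_numer_denom(1,2)[of q] assms(1) by (metis of_int_0_less_iff zero_less_divide_iff not_less_iff_gr_or_eq)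
  ultimately show "numer q \<ge> 2" by linarith
qed

theorem proposition3p9:
  fixes q :: rat and n :: nat and \<alpha> :: real
  assumes "q > 0"
    and "q \<notin> \<int>"
    and "\<not> (\<exists>m::int. q = 1 / of_int m)"
    and "n > 0"
    and "\<alpha> > 0"
    and "irreducible_root n q \<alpha>"
  shows "atomic_monoid (nat_poly_values \<alpha>) \<and>
         atoms (nat_poly_values \<alpha>) = {\<alpha> ^ k | k :: nat. True} \<and>
         (\<forall>b\<in>nat_poly_values \<alpha>. b \<noteq> 0 \<longrightarrow>
            arith_progression \<bar>numer q - denom q\<bar> (int ` length_set (nat_poly_values \<alpha>) b))"
proof -
  note ge_2 = numer_denom_ge_2[OF assms(1-3)]
  define a c where "a = nat (numer q)" and "c = nat (denom q)"
  have num: "numer q = int a" and den: "denom q = int c"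
    using ge_2 by (simp_all add: a_def c_def)
  have "\<alpha> ^ n = of_int (numer q) / of_int (denom q)"
    using assms(6) quotient_numer_denom(1)[of q]
    by (metis irreducible_root_def of_rat_divide of_rat_of_int_eq)
  then have rel: "real a * \<alpha> ^ i = real c * \<alpha> ^ (i + n)" for i
    using ge_2 by (simp add: num den power_add)
  have "a \<noteq> c" using quotient_numer_denom(3)[of q] ge_2 by (auto simp: num den)
  then consider "a < c" | "c < a" by linarith
  then obtain x y I s where "exchange \<alpha> x y I s" and diff: "\<bar>numer q - denom q\<bar> = int x - int y"
  proof cases
    case 1
    \<comment> \<open>For \<open>q < 1\<close> the shortening exchange lowers exponents by
      \<open>n\<close>, so it applies only from \<open>n\<close> on.\<close>
    have "exchange \<alpha> c a {n..} (\<lambda>i. i - n)"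
    proof
      show "real c * \<alpha> ^ i = real a * \<alpha> ^ (i - n)" if "i \<in> {n..}" for i
        using rel[of "i - n"] that by simp
      show "m = m'"
        if "\<And>i. i \<in> {n..} \<Longrightarrow> count m i < c" "\<And>i. i \<in> {n..} \<Longrightarrow> count m' i < c"
          "weight \<alpha> m = weight \<alpha> m'" for m m'
        using eq_if_counts_less_denom[OF assms(5,6,4)] that by (simp add: den)
    qed (use assms(5) 1 ge_2 in \<open>auto simp: num\<close>)
    then show ?thesis using that 1 by (simp add: num den)
  next
    case 2
    \<comment> \<open>For \<open>q > 1\<close> it raises exponents by \<open>n\<close> and applies
      everywhere.\<close>
    have "exchange \<alpha> a c UNIV (\<lambda>i. i + n)"
    proof
      show "m = m'"
        if "\<And>i. i \<in> UNIV \<Longrightarrow> count m i < a" "\<And>i. i \<in> UNIV \<Longrightarrow> count m' i < a"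
          "weight \<alpha> m = weight \<alpha> m'" for m m'
        using eq_if_counts_less_numer[OF assms(1,5,6,4)] that by (simp add: num)
    qed (use assms(5) 2 ge_2 rel in \<open>auto simp: den\<close>)
    then show ?thesis using that 2 by (simp add: num den)
  qed
  interpret exchange \<alpha> x y I s by fact
  show ?thesis using atomic atoms_eq arith_progression_lengths by (auto simp: diff)
qed

end
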